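(* Let $d,n\in\mathbb{N}$. Let $\gamma:[0,1]\to\mathbb{T}^d$ be a continuous, piecewise differentiable closed curve with at most finitely many self-intersections, with trajectory $\Gamma=\gamma([0,1])$ whose covering radius satisfies $\delta_\Gamma\le 1/8$, and let $w:\Gamma\to[0,\infty)$ be a non-negative weight function such that $$\frac{1}{\ell(\gamma)}\int_\gamma f(x)w(x)\,\mathrm{d}\sigma(x)=\int_{\mathbb{T}^d}f(x)\,\mathrm{d}x\qquad\text{for all } f\in\Pi_{2n}^d.$$ Then $$\ell(\gamma)\ge\frac{1}{2^{d(d+1)}}\,(2n+1)^{d-1}.$$
   Context: $\mathbb{N}=\{1,2,\dots\}$. $\mathbb{T}^d\simeq[0,1)^d$ is the $d$-dimensional torus ($\mathbb{R}^d/\mathbb{Z}^d$) with normalized Lebesgue measure $\mathrm{d}x$. For $N\in\mathbb{N}$, $\Pi_N^d$ is the space of trigonometric polynomials $f(x)=\sum_{k\in\mathbb{Z}^d,\ \|k\|_\infty\le N}c_k\,\mathrm{e}^{2\pi i k\cdot x}$, $c_k\in\mathbb{C}$, on $\mathbb{T}^d$. Covering radius of a set $Y\subset\mathbb{T}^d$: $\delta_Y=\sup_{x\in\mathbb{T}^d}\inf_{y\in Y}|y-x|_\infty$ with $|x-y|_\infty=\inf_{z\in\mathbb{Z}^d}\|x-y+z\|_\infty$. Integration along a curve is with respect to arc length, $\int_\gamma g(x)\,\mathrm{d}\sigma(x)=\int_0^1 g(\gamma(t))\|\dot\gamma(t)\|_2\,\mathrm{d}t$, and the length is $\ell(\gamma)=\int_\gamma\mathrm{d}\sigma(x)=\int_0^1\|\dot\gamma(t)\|_2\,\mathrm{d}t$.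 The weight $w$ is implicitly assumed measurable so that all integrals are well defined. *)

theory Defs
  imports "HOL-Analysis.Analysis"
begin

definition int_vec :: "int ^ 'd::finite \<Rightarrow> real ^ 'd"
  where "int_vec z = (\<chi> i. of_int (z $ i))"

lemma int_vec_add: "int_vec (a + b) = int_vec a + int_vec b"
  and int_vec_diff: "int_vec (a - b) = int_vec a - int_vec b"
  and int_vec_minus: "int_vec (- a) = - int_vec a"
  and int_vec_zero: "int_vec 0 = 0"
  by (simp_all add: int_vec_def vec_eq_iff)

definition torus_rel :: "real ^ 'd::finite \<Rightarrow> real ^ 'd \<Rightarrow> bool"
  where "torus_rel x y \<longleftrightarrow> (\<exists>z. x - y = int_vec z)"

lemma equivp_torus_rel: "equivp (torus_rel :: real ^ 'd::finite \<Rightarrow> _)"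
proof (rule equivpI)
  show "reflp (torus_rel :: real ^ 'd::finite \<Rightarrow> _)"
    unfolding reflp_def torus_rel_def by (metis cancel_comm_monoid_add_class.diff_cancel int_vec_zero)
  show "symp (torus_rel :: real ^ 'd::finite \<Rightarrow> _)"
    unfolding symp_def torus_rel_def by (metis minus_diff_eq int_vec_minus)
  show "transp (torus_rel :: real ^ 'd::finite \<Rightarrow> _)"
    unfolding transp_def torus_rel_def by (metis diff_add_cancel add_diff_eq int_vec_add)
qed

text \<open>The torus \<open>\<real>\<^sup>d/\<int>\<^sup>d\<close> with \<open>d = CARD('d)\<close>.\<close>

quotient_type 'd torus = "real ^ 'd::finite" / torus_rel
  morphisms rep_torus to_torus
  by (rule equivp_torus_rel)

lemma to_torus_eq_iff: "to_torus x = to_torus y \<longleftrightarrow> (\<exists>z. x - y = int_vec z)"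
  using torus.abs_eq_iff torus_rel_def by metis

definition dist_mod_int :: "real ^ 'd::finite \<Rightarrow> real ^ 'd \<Rightarrow> real"
  where "dist_mod_int x y = (INF z. infnorm (x - y + int_vec z))"

lemma dist_mod_int_le: "dist_mod_int x y \<le> infnorm (x - y + int_vec z)"
  unfolding dist_mod_int_def
  by (rule cINF_lower) (auto intro!: bdd_belowI2[where m = 0] infnorm_pos_le)

lemma dist_mod_int_approx:
  assumes "e > 0"
  obtains z where "infnorm (x - y + int_vec z) < dist_mod_int x y + e"
proof -
  have "(INF z. infnorm (x - y + int_vec z)) < dist_mod_int x y + e"
    using assms by (simp add: dist_mod_int_def)
  moreover have "bdd_below (range (\<lambda>z. infnorm (x - y + int_vec z)))"
    by (auto intro!: bdd_belowI2[where m = 0] infnorm_pos_le)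
  ultimately obtain z where "infnorm (x - y + int_vec z) < dist_mod_int x y + e"
    by (auto simp: cINF_less_iff)
  then show ?thesis by (rule that)
qed

lemma dist_mod_int_nonneg: "0 \<le> dist_mod_int x y"
  unfolding dist_mod_int_def by (rule cINF_greatest) (auto intro: infnorm_pos_le)

lemma dist_mod_int_sym_le: "dist_mod_int x y \<le> dist_mod_int y x"
proof (rule field_le_epsilon)
  fix e :: real assume "e > 0"
  then obtain z where z: "infnorm (y - x + int_vec z) < dist_mod_int y x + e"
    by (rule dist_mod_int_approx)
  have "x - y + int_vec (- z) = - (y - x + int_vec z)"
    by (simp add: int_vec_minus)
  then have "infnorm (x - y + int_vec (- z)) = infnorm (y - x + int_vec z)"
    by (metis infnorm_neg)
  then show "dist_mod_int x y \<le> dist_mod_int y x + e"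
    using z dist_mod_int_le[of x y "- z"] by linarith
qed

lemma dist_mod_int_triangle: "dist_mod_int x y \<le> dist_mod_int x u + dist_mod_int u y"
proof (rule field_le_epsilon)
  fix e :: real assume "e > 0"
  then have e2: "e / 2 > 0" by simp
  obtain a where a: "infnorm (x - u + int_vec a) < dist_mod_int x u + e / 2"
    using e2 by (rule dist_mod_int_approx)
  obtain b where b: "infnorm (u - y + int_vec b) < dist_mod_int u y + e / 2"
    using e2 by (rule dist_mod_int_approx)
  have "x - y + int_vec (a + b) = (x - u + int_vec a) + (u - y + int_vec b)"
    by (simp add: int_vec_add)
  then have "infnorm (x - y + int_vec (a + b))
      \<le> infnorm (x - u + int_vec a) + infnorm (u - y + int_vec b)"
    by (metis infnorm_triangle)
  then show "dist_mod_int x y \<le> dist_mod_int x u + dist_mod_int u y + e"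
    using a b dist_mod_int_le[of x y "a + b"] by linarith
qed

lemma dist_mod_int_0_iff: "dist_mod_int x y = 0 \<longleftrightarrow> torus_rel x y"
proof
  assume 0: "dist_mod_int x y = 0"
  have "(x - y) $ i \<in> \<int>" for i
  proof -
    have "\<exists>r\<in>\<int>. dist r ((x - y) $ i) < e" if e: "e > 0" for e :: real
    proof -
      obtain z where z: "infnorm (x - y + int_vec z) < e"
        using dist_mod_int_approx[OF e, of x y] 0 by auto
      have "\<bar>(x - y + int_vec z) $ i\<bar> < e"
        using component_le_infnorm_cart[of "x - y + int_vec z" i] z by linarith
      then have "dist (of_int (- (z $ i))) ((x - y) $ i) < e"
        by (simp add: dist_real_def int_vec_def abs_minus_commute algebra_simps)
      then show ?thesis by (meson Ints_of_int)
    qed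
    then have "(x - y) $ i \<in> closure (\<int> :: real set)"
      unfolding closure_approachable by blast
    then show ?thesis by (metis closed_Ints closure_closed)
  qed
  then have "x - y = int_vec (\<chi> i. \<lfloor>(x - y) $ i\<rfloor>)"
    unfolding int_vec_def vec_eq_iff vec_lambda_beta by (metis floor_of_int Ints_cases)
  then show "torus_rel x y" by (auto simp: torus_rel_def)
next
  assume "torus_rel x y"
  then obtain z where "x - y = int_vec z" by (auto simp: torus_rel_def)
  then have "dist_mod_int x y \<le> 0"
    using dist_mod_int_le[of x y "- z"] by (simp add: int_vec_minus infnorm_0)
  then show "dist_mod_int x y = 0"
    using dist_mod_int_nonneg[of x y] by linarith
qed

instantiation torus :: (finite) metric_space
begin

lift_definition dist_torus :: "'a torus \<Rightarrow> 'a torus \<Rightarrow> real" is dist_mod_int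
proof -
  fix x x' y y' :: "real ^ 'a"
  assume "torus_rel x x'" "torus_rel y y'"
  then have z: "dist_mod_int x x' = 0" "dist_mod_int y y' = 0"
    by (simp_all add: dist_mod_int_0_iff)
  have sym: "dist_mod_int u v = dist_mod_int v u" for u v :: "real ^ 'a"
    by (intro antisym dist_mod_int_sym_le)
  show "dist_mod_int x y = dist_mod_int x' y'"
    using z sym dist_mod_int_triangle[of x y x'] dist_mod_int_triangle[of x' y y']
      dist_mod_int_triangle[of x' y' x] dist_mod_int_triangle[of x y' y]
    by (smt (verit))
qed

definition uniformity_torus :: "('a torus \<times> 'a torus) filter"
  where "uniformity_torus = (INF e\<in>{0 <..}. principal {(x, y). dist x y < e})"

definition open_torus :: "'a torus set \<Rightarrow> bool"
  where "open_torus U \<longleftrightarrow> (\<forall>x\<in>U. eventually (\<lambda>(x', y). x' = x \<longrightarrow> y \<in> U) uniformity)"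

instance
proof
  fix x y z :: "'a torus"
  show "dist x y = 0 \<longleftrightarrow> x = y"
    by transfer (rule dist_mod_int_0_iff)
  have "dist y z = dist z y"
    by transfer (intro antisym dist_mod_int_sym_le)
  moreover have "dist x y \<le> dist x z + dist z y"
    by transfer (rule dist_mod_int_triangle)
  ultimately show "dist x y \<le> dist x z + dist y z" by simp
qed (simp_all add: uniformity_torus_def open_torus_def)

end

lemma dist_to_torus:
  "dist (to_torus x) (to_torus y) = (INF z. infnorm (x - y + int_vec z))"
  by (simp add: dist_torus.abs_eq dist_mod_int_def)

lemma continuous_on_to_torus: "continuous_on S to_torus"
proof (rule continuous_on_subset[OF _ subset_UNIV], unfold continuous_on_iff, intro ballI allI impI)
  fix x :: "real ^ 'a" and e :: real assume "e > 0"
  have "dist (to_torus y) (to_torus x) \<le> dist y x" for y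
    using dist_mod_int_le[of y x 0] infnorm_le_norm[of "y - x"]
    by (simp add: dist_torus.abs_eq int_vec_zero dist_norm)
  then show "\<exists>d>0. \<forall>y\<in>UNIV. dist y x < d \<longrightarrow> dist (to_torus y) (to_torus x) < e"
    using \<open>e > 0\<close> by (meson le_less_trans)
qed

definition torus_measure :: "('d::finite) torus measure"
  where "torus_measure =
    distr (restrict_space lborel {x :: real ^ 'd. \<forall>i. 0 \<le> x $ i \<and> x $ i < 1}) borel to_torus"

definition covering_radius :: "('d::finite) torus set \<Rightarrow> real"
  where "covering_radius Y = (SUP x. INF y\<in>Y. dist y x)"

lift_definition torus_char :: "int ^ 'd \<Rightarrow> ('d::finite) torus \<Rightarrow> complex"
  is "\<lambda>k x. exp (2 * pi * \<i> * complex_of_real (int_vec k \<bullet> x))"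
proof -
  fix k :: "int ^ 'd" and x y :: "real ^ 'd"
  assume "torus_rel x y"
  then obtain z where "x - y = int_vec z" by (auto simp: torus_rel_def)
  then have x: "x = y + int_vec z" by (simp add: algebra_simps)
  have "int_vec k \<bullet> int_vec z = of_int (\<Sum>i\<in>UNIV. k $ i * z $ i)"
    by (simp add: inner_vec_def int_vec_def)
  then have "2 * pi * \<i> * complex_of_real (int_vec k \<bullet> x) =
      2 * pi * \<i> * complex_of_real (int_vec k \<bullet> y)
        + complex_of_real (real_of_int (2 * (\<Sum>i\<in>UNIV. k $ i * z $ i)) * pi) * \<i>"
    unfolding x inner_add_right of_real_add by (simp add: algebra_simps)
  then show "exp (2 * pi * \<i> * complex_of_real (int_vec k \<bullet> x)) =
      exp (2 * pi * \<i> * complex_of_real (int_vec k \<bullet> y))"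
    unfolding exp_eq by blast
qed

definition trig_freqs :: "nat \<Rightarrow> (int ^ 'd::finite) set"
  where "trig_freqs N = {k. \<forall>i. \<bar>k $ i\<bar> \<le> int N}"

lemma finite_trig_freqs: "finite (trig_freqs N :: (int ^ 'd::finite) set)"
proof -
  have "finite {f :: 'd \<Rightarrow> int. \<forall>i. (i \<in> UNIV \<longrightarrow> f i \<in> {- int N..int N}) \<and> (i \<notin> UNIV \<longrightarrow> f i = 0)}"
    by (rule finite_set_of_finite_funs) auto
  then have "finite (vec_lambda ` {f :: 'd \<Rightarrow> int. \<forall>i. f i \<in> {- int N..int N}})"
    by simp
  moreover have "trig_freqs N \<subseteq> vec_lambda ` {f :: 'd \<Rightarrow> int. \<forall>i. f i \<in> {- int N..int N}}"
  proof
    fix k :: "int ^ 'd" assume "k \<in> trig_freqs N"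
    then have "vec_nth k \<in> {f. \<forall>i. f i \<in> {- int N..int N}}"
      by (simp add: trig_freqs_def abs_le_iff minus_le_iff)
    then show "k \<in> vec_lambda ` {f :: 'd \<Rightarrow> int. \<forall>i. f i \<in> {- int N..int N}}"
      by (metis image_eqI vec_nth_inverse)
  qed
  ultimately show ?thesis by (rule finite_subset[rotated])
qed

definition trig_poly :: "nat \<Rightarrow> (('d::finite) torus \<Rightarrow> complex) set"
  where "trig_poly N = {f. \<exists>c. f = (\<lambda>x. \<Sum>k\<in>trig_freqs N. c k * torus_char k x)}"

text \<open>
  A curve \<open>[0,1] \<rightarrow> \<real>\<^sup>d/\<int>\<^sup>d\<close> is a function on the reals of which only the values on \<open>{0..1}\<close> matter.
  Its derivative is that of a lift to \<open>\<real>\<^sup>d\<close>.  The lift \<open>g\<close> below is only required to be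
  differentiable at \<open>t\<close> and may jump by integer vectors elsewhere, so this is a local condition at
  \<open>t\<close>; two such lifts differ by a constant integer vector near \<open>t\<close>, so \<open>v\<close> is unique.
\<close>

definition has_velocity :: "(real \<Rightarrow> ('d::finite) torus) \<Rightarrow> real ^ 'd \<Rightarrow> real \<Rightarrow> bool"
  where "has_velocity \<gamma> v t \<longleftrightarrow>
    (\<exists>g. (\<forall>s\<in>{0..1}. \<gamma> s = to_torus (g s)) \<and> (g has_vector_derivative v) (at t within {0..1}))"

definition velocity :: "(real \<Rightarrow> ('d::finite) torus) \<Rightarrow> real \<Rightarrow> real ^ 'd"
  where "velocity \<gamma> t = (THE v. has_velocity \<gamma> v t)"

text \<open>The analogue of \<^const>\<open>piecewise_differentiable_on\<close> for torus-valued curves on \<open>{0..1}\<close>.\<close>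

definition piecewise_differentiable_curve :: "(real \<Rightarrow> ('d::finite) torus) \<Rightarrow> bool"
  where "piecewise_differentiable_curve \<gamma> \<longleftrightarrow> continuous_on {0..1} \<gamma> \<and>
    (\<exists>S. finite S \<and> (\<forall>t\<in>{0..1} - S. \<exists>v. has_velocity \<gamma> v t))"

text \<open>The parameter \<open>1\<close> is left out since \<open>\<gamma> 0 = \<gamma> 1\<close> is not a self-intersection of a closed curve.\<close>

definition self_intersections :: "(real \<Rightarrow> ('d::finite) torus) \<Rightarrow> ('d torus) set"
  where "self_intersections \<gamma> = {x. \<exists>s t. 0 \<le> s \<and> s < t \<and> t < 1 \<and> \<gamma> s = x \<and> \<gamma> t = x}"

definition curve_integral ::
    "(real \<Rightarrow> ('d::finite) torus) \<Rightarrow> ('d torus \<Rightarrow> 'b::{banach, second_countable_topology}) \<Rightarrow> 'b"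
  where "curve_integral \<gamma> g = (LINT t|lebesgue_on {0..1}. norm (velocity \<gamma> t) *\<^sub>R g (\<gamma> t))"

text \<open>
  If the speed is not Lebesgue integrable (infinite length), the value is \<open>0\<close>.  A quadrature
  identity with the factor \<open>1 / curve_length \<gamma>\<close> that is exact for the constant \<open>1\<close> then fails, as it
  also does for the length \<open>\<infinity>\<close>.
\<close>

definition curve_length :: "(real \<Rightarrow> ('d::finite) torus) \<Rightarrow> real"
  where "curve_length \<gamma> = curve_integral \<gamma> (\<lambda>_. 1)"

end

theory Submission
  imports Defs
begin

text \<open>
  Let \<open>N = 2 n + 1\<close>.  The squared modulus \<open>F\<close> of the Dirichlet kernel of \<open>\<Pi>\<^sub>n\<close> centred at \<open>q\<close> lies in
  \<open>\<Pi>\<^sub>2\<^sub>n\<close>, is non-negative, has mean \<open>N\<^sup>d\<close>, and is at least \<open>N\<^sup>2\<^sup>d / 4\<close> within distance \<open>1 / (3 d N)\<close>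
  of \<open>q\<close>, where all its frequencies have phase at most \<open>\<pi> / 3\<close>.  By the quadrature identity, such a
  small ball therefore carries at most the fraction \<open>4 / N\<^sup>d\<close> of the mass of \<open>w d\<sigma>\<close>.  A curve of
  length \<open>l\<close> is covered by at most \<open>3 d N l + 1\<close> of these balls, so \<open>N\<^sup>d \<le> 4 (3 d N l + 1)\<close>.  The
  covering radius forces \<open>l \<ge> 1/3\<close>, hence \<open>N l \<ge> 1\<close>, and thus \<open>N\<^sup>d\<^sup>-\<^sup>1 \<le> 4 (3 d + 1) l\<close>.  This gives the
  claim for \<open>d \<ge> 2\<close>, while for \<open>d = 1\<close> it is contained in \<open>l \<ge> 1/3\<close>.
\<close>

section \<open>Characters and the metric of the torus\<close>

lemma torus_char_to_torus:
  "torus_char k (to_torus x) = exp (2 * pi * \<i> * complex_of_real (int_vec k \<bullet> x))"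
  by (rule torus_char.abs_eq)

lemma to_torus_cases: obtains u where "x = to_torus u"
  by (metis Quotient_abs_rep[OF Quotient_torus])

lemma torus_char_add: "torus_char (a + b) x = torus_char a x * torus_char b x"
  by (rule to_torus_cases[of x])
    (simp add: torus_char_to_torus int_vec_add inner_add_left algebra_simps flip: exp_add)

lemma torus_char_0: "torus_char 0 x = 1"
  by (rule to_torus_cases[of x]) (simp add: torus_char_to_torus int_vec_zero)

lemma norm_torus_char: "norm (torus_char k x) = 1"
  by (rule to_torus_cases[of x]) (simp add: torus_char_to_torus)

lemma torus_char_minus: "torus_char (- k) x = cnj (torus_char k x)"
  by (rule to_torus_cases[of x])
    (simp add: torus_char_to_torus int_vec_minus exp_cnj)

lemma torus_char_to_torus_add:
  "torus_char k (to_torus (x + y)) = torus_char k (to_torus x) * torus_char k (to_torus y)"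
  by (simp add: torus_char_to_torus inner_add_right algebra_simps flip: exp_add)

lemma to_torus_add_int_vec: "to_torus (x + int_vec z) = to_torus x"
  by (auto simp: to_torus_eq_iff)

lemma dist_to_torus_le: "dist (to_torus x) (to_torus y) \<le> norm (x - y)"
  using dist_mod_int_le[of x y 0] infnorm_le_norm[of "x - y"]
  by (simp add: dist_torus.abs_eq int_vec_zero)

text \<open>A crude bound on the diameter suffices: it serves to show that the supremum over real
  numbers in \<open>covering_radius\<close> is taken over a bounded family.\<close>

lemma dist_torus_bounded: "dist (x :: 'd::finite torus) y \<le> real CARD('d)"
proof -
  obtain u v where uv: "x = to_torus u" "y = to_torus v" by (metis to_torus_cases)
  \<comment> \<open>Shifting by the floors moves every coordinate of the difference into
    [0,1).\<close>
  define z :: "int ^ 'd" where "z = (\<chi> i. - \<lfloor>(u - v) $ i\<rfloor>)"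
  have "\<bar>(u + int_vec z - v) $ i\<bar> \<le> 1" for i
    by (simp add: z_def int_vec_def) linarith
  then have "(\<Sum>i\<in>UNIV. \<bar>(u + int_vec z - v) $ i\<bar>) \<le> (\<Sum>i\<in>(UNIV :: 'd set). 1)"
    by (rule sum_mono)
  then have "norm (u + int_vec z - v) \<le> real CARD('d)"
    using norm_le_l1_cart[of "u + int_vec z - v"] by simp
  then show ?thesis
    using dist_to_torus_le[of "u + int_vec z" v] by (simp add: uv to_torus_add_int_vec)
qed

text \<open>Characters are homomorphisms of modulus 1, so continuity at 0 carries over to every
  point. A small quotient distance supplies a small representative of the difference.\<close>

lemma continuous_on_torus_char: "continuous_on S (torus_char (k :: int ^ 'd::finite))"
  unfolding continuous_on_iff
proof (intro ballI allI impI)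
  fix x :: "'d torus" and e :: real assume "e > 0"
  obtain u where u: "x = to_torus u" by (rule to_torus_cases)
  have "isCont (\<lambda>h. torus_char k (to_torus h)) 0"
    unfolding torus_char_to_torus by (intro continuous_intros)
  then obtain r where r: "r > 0"
    "\<And>h. norm h < r \<Longrightarrow> norm (torus_char k (to_torus h) - 1) < e"
    using \<open>e > 0\<close> unfolding continuous_at_eps_delta dist_norm
    by (auto simp: torus_char_to_torus)
  \<comment> \<open>This constant compares the Euclidean norm with the maximum norm, from which the
    torus distance is built.\<close>
  define c where "c = sqrt (real DIM(real ^ 'd))"
  have c: "c > 0" by (simp add: c_def)
  have "dist (torus_char k y) (torus_char k x) < e" if y: "dist y x < r / c" for y
  proof -
    obtain v where v: "y = to_torus v" by (rule to_torus_cases)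
    obtain z where z: "infnorm (v - u + int_vec z) < r / c"
      using dist_mod_int_approx[of "r / c - dist y x" v u] y
      by (auto simp: u v dist_torus.abs_eq)
    have "norm (v - u + int_vec z) \<le> c * infnorm (v - u + int_vec z)"
      unfolding c_def by (rule norm_le_infnorm)
    also have "\<dots> < r" using z c by (simp add: field_simps)
    finally have n: "norm (torus_char k (to_torus (v - u + int_vec z)) - 1) < e" by (rule r)
    have "y = to_torus (u + (v - u + int_vec z))"
      by (simp add: v to_torus_add_int_vec)
    then have "torus_char k y - torus_char k x =
        torus_char k x * (torus_char k (to_torus (v - u + int_vec z)) - 1)"
      by (simp only: torus_char_to_torus_add u) (simp add: algebra_simps)
    then show ?thesis using n by (simp add: dist_norm norm_mult norm_torus_char)
  qed
  then show "\<exists>d>0. \<forall>y\<in>S. dist y x < d \<longrightarrow> dist (torus_char k y) (torus_char k x) < e"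
    using r(1) c by (intro exI[of _ "r / c"]) auto
qed

section \<open>Orthogonality of the characters\<close>

text \<open>Lebesgue measure is the image of the product of one-dimensional Lebesgue measures over
  the basis, so Fubini splits the integral of a product of functions of single coordinates.\<close>

lemma integral_lborel_prod:
  fixes h :: "'a::euclidean_space \<Rightarrow> real \<Rightarrow> 'b::{real_normed_field, banach, second_countable_topology}"
  assumes "\<And>b. b \<in> Basis \<Longrightarrow> integrable lborel (h b)"
  shows "(LINT x|lborel. (\<Prod>b\<in>Basis. h b (x \<bullet> b))) = (\<Prod>b\<in>Basis. integral\<^sup>L lborel (h b))"
proof -
  interpret product_sigma_finite "\<lambda>_::'a. lborel :: real measure" ..
  have [measurable]: "h b \<in> borel_measurable borel" if "b \<in> Basis" for b
    using borel_measurable_integrable[OF assms[OF that]] by simp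
  have "(LINT x|lborel. (\<Prod>b\<in>Basis. h b (x \<bullet> b))) =
      (LINT f|(\<Pi>\<^sub>M b\<in>Basis. lborel). (\<Prod>b\<in>Basis. h b ((\<Sum>c\<in>Basis. f c *\<^sub>R c) \<bullet> b)))"
    by (subst lborel_eq, subst integral_distr) simp_all
  also have "\<dots> = (LINT f|(\<Pi>\<^sub>M b\<in>Basis. lborel). (\<Prod>b\<in>Basis. h b (f b)))"
    by simp
  finally show ?thesis by (simp add: product_integral_prod assms)
qed

text \<open>The half-open interval is a side of the fundamental cube. It differs from the closed
  interval, on which the fundamental theorem applies, by a null set.\<close>

lemma exp_period_integral:
  "integrable lborel (\<lambda>t. indicator {0..<1} t *\<^sub>R exp (2 * pi * \<i> * complex_of_real (of_int m * t)))"
  "(LINT t|lborel. indicator {0..<1} t *\<^sub>R exp (2 * pi * \<i> * complex_of_real (of_int m * t)))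
    = (if m = 0 then 1 else 0)"
proof -
  let ?e = "\<lambda>t. exp (2 * pi * \<i> * complex_of_real (of_int m * t))"
  have int: "integrable lborel (\<lambda>t. indicator {0..1} t *\<^sub>R ?e t)"
    unfolding set_integrable_def[symmetric]
    by (intro borel_integrable_atLeastAtMost') (intro continuous_intros)
  have AE: "AE t in lborel. indicator {0..1::real} t *\<^sub>R ?e t = indicator {0..<1} t *\<^sub>R ?e t"
    using AE_lborel_singleton[of "1 :: real"]
    by eventually_elim (auto simp: indicator_def)
  show "integrable lborel (\<lambda>t. indicator {0..<1} t *\<^sub>R ?e t)"
    using int by (rule integrable_cong_AE_imp[OF _ _ AE]) measurable
  have "(LINT t|lborel. indicator {0..<1} t *\<^sub>R ?e t) = (LINT t|lborel. indicator {0..1} t *\<^sub>R ?e t)"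
    using AE by (intro integral_cong_AE) (measurable, auto elim: eventually_mono)
  also have "\<dots> = (if m = 0 then 1 else 0)"
  proof (cases "m = 0")
    case False
    define c where "c = 2 * pi * \<i> * complex_of_real (of_int m)"
    have c: "c \<noteq> 0" using False by (simp add: c_def)
    have e: "?e t = exp (c * complex_of_real t)" for t by (simp add: c_def mult_ac)
    have "(LINT t|lborel. indicator {0..1} t *\<^sub>R ?e t) = exp (c * complex_of_real 1) / c - exp (c * complex_of_real 0) / c"
      unfolding e
    proof (rule integral_FTC_Icc)
      show "((\<lambda>t. exp (c * complex_of_real t) / c) has_vector_derivative exp (c * complex_of_real t))
          (at t within {0..1})" for t :: real
      proof -
        have "((\<lambda>w. exp (c * w) / c) has_field_derivative exp (c * complex_of_real t)) (at (complex_of_real t))"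
          using c by (auto intro!: derivative_eq_intros)
        then show ?thesis
          using has_vector_derivative_real_field has_vector_derivative_at_within by blast
      qed
    qed (auto intro!: continuous_intros)
    \<comment> \<open>By periodicity the antiderivative takes the same value at both
      endpoints.\<close>
    moreover have "exp c = 1"
      using exp_integer_2pi[of "of_int m"] by (simp add: c_def mult_ac)
    ultimately show ?thesis using False by simp
  qed simp
  finally show "(LINT t|lborel. indicator {0..<1} t *\<^sub>R ?e t) = (if m = 0 then 1 else 0)" .
qed

lemma measurable_to_torus: "to_torus \<in> borel_measurable borel"
  by (rule borel_measurable_continuous_onI) (rule continuous_on_to_torus)

lemma measurable_torus_char: "torus_char k \<in> borel_measurable borel"
  by (rule borel_measurable_continuous_onI) (rule continuous_on_torus_char)

text \<open>On the unit cube a character is a product of one-dimensional exponentials, and a single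
  nonzero frequency coordinate makes one factor of the integral vanish.\<close>

lemma integral_torus_char:
  "(LINT x|torus_measure. torus_char (k :: int ^ 'd::finite) x) = (if k = 0 then 1 else 0)"
proof -
  let ?C = "{x :: real ^ 'd. \<forall>i. 0 \<le> x $ i \<and> x $ i < 1}"
  define h where "h b t = indicator {0..<1} t *\<^sub>R exp (2 * pi * \<i> * complex_of_real ((int_vec k \<bullet> b) * t))"
    for b :: "real ^ 'd" and t :: real
  have ax: "int_vec k \<bullet> axis i 1 = of_int (k $ i)" for i
    by (simp add: inner_axis int_vec_def)
  have C: "?C \<in> sets lborel" by measurable
  have h: "integrable lborel (h b)" "integral\<^sup>L lborel (h (axis i 1)) = (if k $ i = 0 then 1 else 0)"
    if "b \<in> Basis" for b i
  proof -
    have "h (axis i 1) = (\<lambda>t. indicator {0..<1} t *\<^sub>R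
        exp (2 * pi * \<i> * complex_of_real (of_int (k $ i) * t)))" for i
      by (simp add: h_def ax fun_eq_iff)
    then show "integrable lborel (h b)"
      "integral\<^sup>L lborel (h (axis i 1)) = (if k $ i = 0 then 1 else 0)"
      using that exp_period_integral by (auto simp only: Basis_vec_def Basis_real_def singleton_iff)
  qed
  have "(LINT x|torus_measure. torus_char k x) =
      (LINT x|lborel. indicator ?C x *\<^sub>R torus_char k (to_torus x))"
    unfolding torus_measure_def using C
    by (simp add: integral_distr measurable_restrict_space1 measurable_to_torus
        measurable_torus_char integral_restrict_space)
  also have "\<dots> = (LINT x|lborel. (\<Prod>b\<in>Basis. h b (x \<bullet> b)))"
  proof (rule Bochner_Integration.integral_cong[OF refl])
    fix x :: "real ^ 'd"
    \<comment> \<open>The indicator of the cube must factor as well, so that the whole integrand has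
      product form.\<close>
    have "(\<Prod>b\<in>Basis. indicator {0..<1} (x \<bullet> b) :: complex) = indicator ?C x"
    proof (cases "x \<in> ?C")
      case True
      then show ?thesis by (auto simp: indicator_def Basis_vec_def inner_axis intro!: prod.neutral)
    next
      case False
      then obtain i where "x $ i \<notin> {0..<1}" by auto
      then have "\<exists>b\<in>Basis. indicator {0..<1} (x \<bullet> b) = (0 :: complex)"
        by (intro bexI[of _ "axis i 1"]) (auto simp: inner_axis Basis_vec_def)
      with False show ?thesis by (auto simp: indicator_def)
    qed
    moreover have "(\<Sum>b\<in>Basis. (int_vec k \<bullet> b) * (x \<bullet> b)) = int_vec k \<bullet> x"
      by (rule euclidean_inner[symmetric])
    then have "2 * pi * \<i> * complex_of_real (int_vec k \<bullet> x) =
        (\<Sum>b\<in>Basis. 2 * pi * \<i> * complex_of_real ((int_vec k \<bullet> b) * (x \<bullet> b)))"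
      by (simp only: sum_distrib_left[symmetric] of_real_sum[symmetric])
    then have "torus_char k (to_torus x) =
        (\<Prod>b\<in>Basis. exp (2 * pi * \<i> * complex_of_real ((int_vec k \<bullet> b) * (x \<bullet> b))))"
      unfolding torus_char_to_torus by (simp add: exp_sum)
    ultimately show "indicator ?C x *\<^sub>R torus_char k (to_torus x) = (\<Prod>b\<in>Basis. h b (x \<bullet> b))"
      by (simp add: h_def scaleR_conv_of_real prod.distrib of_real_indicator)
  qed
  also have "\<dots> = (\<Prod>b\<in>Basis. integral\<^sup>L lborel (h b))"
    by (rule integral_lborel_prod) (rule h)
  also have "\<dots> = (if k = 0 then 1 else 0)"
  proof (cases "k = 0")
    case True
    then show ?thesis using h by (auto simp: Basis_vec_def intro!: prod.neutral)
  next
    case False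
    then obtain i where "k $ i \<noteq> 0" by (auto simp: vec_eq_iff)
    then have "\<exists>b\<in>Basis. integral\<^sup>L lborel (h b) = 0"
      using h(2)[of "axis i 1" i] by (intro bexI[of _ "axis i 1"]) (auto simp: Basis_vec_def)
    then show ?thesis using False by auto
  qed
  finally show ?thesis .
qed

lemma finite_torus_measure: "finite_measure (torus_measure :: ('d::finite) torus measure)"
proof -
  let ?C = "{x :: real ^ 'd. \<forall>i. 0 \<le> x $ i \<and> x $ i < 1}"
  have C: "?C \<in> sets lborel" by measurable
  have "bounded ?C"
    by (rule bounded_subset[OF bounded_cbox[of 0 1]]) (auto simp: mem_box_cart less_imp_le)
  then have "emeasure lborel ?C < \<infinity>" by (rule emeasure_bounded_finite)
  then have "finite_measure (restrict_space lborel ?C)"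
    using C by (intro finite_measureI) (auto simp: emeasure_restrict_space space_restrict_space)
  then show ?thesis
    unfolding torus_measure_def
    by (rule finite_measure.finite_measure_distr) (simp add: measurable_restrict_space1 measurable_to_torus)
qed

lemma integrable_torus_char: "integrable torus_measure (torus_char k)"
proof -
  have "torus_char k \<in> borel_measurable torus_measure"
    using measurable_torus_char by (simp add: torus_measure_def)
  then show ?thesis
    by (intro finite_measure.integrable_const_bound[OF finite_torus_measure, where B = 1])
      (auto simp: norm_torus_char)
qed

section \<open>Trigonometric polynomials and a kernel concentrated at a point\<close>

lemma torus_char_in_trig_poly:
  assumes "k \<in> trig_freqs N"
  shows "torus_char k \<in> trig_poly N"
proof -
  have "torus_char k = (\<lambda>x. \<Sum>l\<in>trig_freqs N. (if l = k then 1 else 0) * torus_char l x)"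
    using assms by (simp add: if_distrib[of "\<lambda>c. c * _"] finite_trig_freqs cong: if_cong)
  then show ?thesis
    unfolding trig_poly_def by (intro CollectI exI[of _ "\<lambda>l. if l = k then 1 else 0"])
qed

lemma trig_poly_cmult:
  assumes "f \<in> trig_poly N"
  shows "(\<lambda>x. c * f x) \<in> trig_poly N"
proof -
  obtain a where "f = (\<lambda>x. \<Sum>k\<in>trig_freqs N. a k * torus_char k x)"
    using assms by (auto simp: trig_poly_def)
  then have "(\<lambda>x. c * f x) = (\<lambda>x. \<Sum>k\<in>trig_freqs N. (c * a k) * torus_char k x)"
    by (simp add: sum_distrib_left mult.assoc)
  then show ?thesis by (auto simp: trig_poly_def)
qed

lemma trig_poly_sum:
  assumes "\<And>i. i \<in> A \<Longrightarrow> f i \<in> trig_poly N"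
  shows "(\<lambda>x. \<Sum>i\<in>A. f i x) \<in> trig_poly N"
proof -
  have "\<forall>i\<in>A. \<exists>c. f i = (\<lambda>x. \<Sum>k\<in>trig_freqs N. c k * torus_char k x)"
    using assms by (auto simp: trig_poly_def)
  then obtain c where "\<And>i. i \<in> A \<Longrightarrow> f i = (\<lambda>x. \<Sum>k\<in>trig_freqs N. c i k * torus_char k x)"
    by metis
  then have "(\<lambda>x. \<Sum>i\<in>A. f i x) =
      (\<lambda>x. \<Sum>k\<in>trig_freqs N. (\<Sum>i\<in>A. c i k) * torus_char k x)"
    by (simp add: sum_distrib_right sum.swap[of _ A])
  then show ?thesis by (auto simp: trig_poly_def)
qed

lemma card_trig_freqs: "card (trig_freqs N :: (int ^ 'd::finite) set) = (2 * N + 1) ^ CARD('d)"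
proof -
  have "trig_freqs N = vec_lambda ` (UNIV \<rightarrow>\<^sub>E {- int N..int N} :: ('d \<Rightarrow> int) set)"
  proof (intro equalityI subsetI)
    fix k :: "int ^ 'd" assume "k \<in> trig_freqs N"
    then have "vec_nth k \<in> UNIV \<rightarrow>\<^sub>E {- int N..int N}"
      by (auto simp: trig_freqs_def abs_le_iff minus_le_iff)
    then show "k \<in> vec_lambda ` (UNIV \<rightarrow>\<^sub>E {- int N..int N})"
      by (metis image_eqI vec_nth_inverse)
  qed (auto simp: trig_freqs_def abs_le_iff minus_le_iff PiE_iff)
  moreover have "inj_on vec_lambda (UNIV \<rightarrow>\<^sub>E {- int N..int N} :: ('d \<Rightarrow> int) set)"
    by (auto intro!: inj_onI simp: vec_lambda_inject)
  ultimately have "card (trig_freqs N :: (int ^ 'd) set) = card (UNIV \<rightarrow>\<^sub>E {- int N..int N} :: ('d \<Rightarrow> int) set)"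
    by (simp only: card_image)
  also have "\<dots> = card {- int N..int N} ^ CARD('d)"
    by (simp only: card_PiE[OF finite] prod_constant)
  also have "card {- int N..int N} = 2 * N + 1" by simp
  finally show ?thesis .
qed

lemma norm_int_vec_le:
  assumes "k \<in> trig_freqs N"
  shows "norm (int_vec (k :: int ^ 'd::finite)) \<le> real CARD('d) * real N"
proof -
  have "\<bar>int_vec k $ i\<bar> \<le> real N" for i
    using assms by (auto simp: trig_freqs_def int_vec_def simp flip: of_int_abs)
       (metis of_int_le_iff of_int_of_nat_eq)
  then have "(\<Sum>i\<in>UNIV. \<bar>int_vec k $ i\<bar>) \<le> (\<Sum>i\<in>(UNIV :: 'd set). real N)"
    by (rule sum_mono)
  then show ?thesis using norm_le_l1_cart[of "int_vec k"] by simp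
qed

text \<open>The centre \<open>q\<close> and the nearby points \<open>y\<close> are vectors rather
  than torus points, since the kernels are later placed along a lift of the curve, where closeness
  is Euclidean.\<close>

lemma concentrated_trig_poly:
  fixes q :: "real ^ 'd::finite"
  obtains F where
    "(\<lambda>x. complex_of_real (F x)) \<in> trig_poly (2 * n)"
    "(LINT x|torus_measure. complex_of_real (F x)) = of_nat ((2 * n + 1) ^ CARD('d))"
    "\<And>x. 0 \<le> F x"
    "\<And>y. norm (y - q) \<le> 1 / (3 * real (2 * n + 1) * real CARD('d)) \<Longrightarrow>
      (real ((2 * n + 1) ^ CARD('d)) / 2)\<^sup>2 \<le> F (to_torus y)"
proof
  let ?T = "trig_freqs n :: (int ^ 'd) set"
  define Q where "Q = to_torus q"
  \<comment> \<open>Each summand is the character of frequency \<open>a\<close> at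
    \<open>x - Q\<close>, so \<open>E\<close> is the Dirichlet kernel translated to
    \<open>Q\<close>.\<close>
  define E where "E x = (\<Sum>a\<in>?T. torus_char (- a) Q * torus_char a x)" for x
  define F where "F x = (norm (E x))\<^sup>2" for x
  have F: "(\<lambda>x. complex_of_real (F x)) =
      (\<lambda>x. \<Sum>a\<in>?T. \<Sum>b\<in>?T. torus_char (b - a) Q * torus_char (a - b) x)"
  proof
    fix x
    have "complex_of_real (F x) = E x * cnj (E x)"
      unfolding F_def by (rule complex_norm_square)
    also have "\<dots> = (\<Sum>a\<in>?T. \<Sum>b\<in>?T.
        (torus_char (- a) Q * torus_char a x) * (torus_char b Q * torus_char (- b) x))"
      by (simp add: E_def sum_product torus_char_minus)
    also have "\<dots> = (\<Sum>a\<in>?T. \<Sum>b\<in>?T. torus_char (b - a) Q * torus_char (a - b) x)"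
      unfolding diff_conv_add_uminus torus_char_add by (simp add: mult_ac)
    finally show "complex_of_real (F x) = \<dots>" .
  qed
  have diff: "a - b \<in> trig_freqs (2 * n)" if "a \<in> ?T" "b \<in> ?T" for a b
    unfolding trig_freqs_def
  proof (intro CollectI allI)
    fix i
    show "\<bar>(a - b) $ i\<bar> \<le> int (2 * n)"
      using that[unfolded trig_freqs_def] abs_triangle_ineq4[of "a $ i" "b $ i"]
      by (auto dest!: spec[of _ i])
  qed
  show "(\<lambda>x. complex_of_real (F x)) \<in> trig_poly (2 * n)"
    unfolding F by (intro trig_poly_sum trig_poly_cmult torus_char_in_trig_poly diff)
  have "(LINT x|torus_measure. complex_of_real (F x)) =
      (\<Sum>a\<in>?T. \<Sum>b\<in>?T. torus_char (b - a) Q * (if a - b = 0 then 1 else 0))"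
    unfolding F
    by (subst Bochner_Integration.integral_sum, simp add: integrable_torus_char,
        subst Bochner_Integration.integral_sum, simp add: integrable_torus_char)
      (simp only: integral_mult_right_zero integral_torus_char)
  \<comment> \<open>Orthogonality leaves only the diagonal, so the mean is the number of
    frequencies.\<close>
  also have "\<dots> = (\<Sum>a\<in>?T. \<Sum>b\<in>?T. if b = a then 1 else 0)"
    by (intro sum.cong refl) (simp add: torus_char_0)
  also have "\<dots> = (\<Sum>a\<in>?T. 1)"
    by (intro sum.cong refl) (simp add: finite_trig_freqs)
  also have "\<dots> = of_nat ((2 * n + 1) ^ CARD('d))"
    by (simp add: card_trig_freqs del: of_nat_power of_nat_add of_nat_mult)
  finally show "(LINT x|torus_measure. complex_of_real (F x)) = of_nat ((2 * n + 1) ^ CARD('d))" .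
  show "0 \<le> F x" for x by (simp add: F_def)
  show "(real ((2 * n + 1) ^ CARD('d)) / 2)\<^sup>2 \<le> F (to_torus y)"
    if y: "norm (y - q) \<le> 1 / (3 * real (2 * n + 1) * real CARD('d))" for y
  proof -
    have half: "1 / 2 \<le> Re (torus_char (- a) Q * torus_char a (to_torus y))" if a: "a \<in> ?T" for a
    proof -
      let ?r = "int_vec a \<bullet> (y - q)"
      \<comment> \<open>The radius is chosen so that the inner product is at most n / (3 (2 n + 1)),
        below 1/6 of a full turn. There the cosine is at least 1/2, so the summands cannot
        cancel.\<close>
      have "\<bar>?r\<bar> \<le> norm (int_vec a) * norm (y - q)" by (rule Cauchy_Schwarz_ineq2)
      also have "\<dots> \<le> (real CARD('d) * real n) * (1 / (3 * real (2 * n + 1) * real CARD('d)))"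
        by (intro mult_mono y norm_int_vec_le[OF a]) auto
      also have "\<dots> = real n / (3 * real (2 * n + 1))" by simp
      also have "\<dots> \<le> 1 / 6" by (simp add: field_simps)
      finally have r: "2 * pi * \<bar>?r\<bar> \<le> pi / 3"
        by (simp add: field_simps)
      have "1 / 2 = cos (pi / 3)" by (simp add: cos_60)
      also have "\<dots> \<le> cos (2 * pi * \<bar>?r\<bar>)"
        using r by (intro cos_monotone_0_pi_le) auto
      also have "2 * pi * \<bar>?r\<bar> = \<bar>2 * pi * ?r\<bar>" by (simp add: abs_mult)
      also have "cos \<bar>2 * pi * ?r\<bar> = cos (2 * pi * ?r)" by (rule cos_abs_real)
      also have "\<dots> = Re (exp (\<i> * complex_of_real (2 * pi * ?r)))"
        by (simp add: Re_exp)
      also have "exp (\<i> * complex_of_real (2 * pi * ?r)) = torus_char (- a) Q * torus_char a (to_torus y)"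
        by (simp add: Q_def torus_char_to_torus int_vec_minus inner_diff_right algebra_simps flip: exp_add)
      finally show ?thesis .
    qed
    have "real ((2 * n + 1) ^ CARD('d)) / 2 = (\<Sum>a\<in>?T. 1 / 2)"
      by (simp add: card_trig_freqs)
    also have "\<dots> \<le> Re (E (to_torus y))"
      unfolding E_def Re_sum by (intro sum_mono half)
    also have "\<dots> \<le> norm (E (to_torus y))" by (rule complex_Re_le_cmod)
    finally show ?thesis unfolding F_def by (intro power_mono) auto
  qed
qed

section \<open>Lifts of curves and arc length\<close>

text \<open>The i-th coordinate character maps the curve into the nonzero complex numbers. A
  continuous logarithm exists since the interval is contractible, and its imaginary part divided by
  2 pi is the i-th coordinate of a lift.\<close>

lemma torus_continuous_lift:
  fixes \<gamma> :: "real \<Rightarrow> ('d::finite) torus"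
  assumes "continuous_on {0..1} \<gamma>"
  obtains g where "continuous_on {0..1} g" "\<And>t. t \<in> {0..1} \<Longrightarrow> \<gamma> t = to_torus (g t)"
proof -
  have "\<exists>l. continuous_on {0..1} l \<and> (\<forall>t\<in>{0..1}. torus_char (axis i 1) (\<gamma> t) = exp (l t))" for i
  proof -
    have "continuous_on {0..1} (\<lambda>t. torus_char (axis i 1) (\<gamma> t))"
      by (rule continuous_on_compose2[OF continuous_on_torus_char assms subset_UNIV])
    moreover have "contractible {0..1 :: real}" by (simp add: convex_imp_contractible)
    moreover have "torus_char (axis i 1) (\<gamma> t) \<noteq> 0" for t
      using norm_torus_char[of "axis i 1" "\<gamma> t"] by auto
    ultimately show ?thesis by (metis continuous_logarithm_on_contractible)
  qed
  then obtain l where l: "\<And>i. continuous_on {0..1} (l i)"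
    "\<And>i t. t \<in> {0..1} \<Longrightarrow> torus_char (axis i 1) (\<gamma> t) = exp (l i t)"
    by metis
  show thesis
  proof
    show "continuous_on {0..1} (\<lambda>t. \<chi> i. Im (l i t) / (2 * pi))"
      by (intro continuous_on_vec_lambda continuous_intros l) auto
    fix t :: real assume t: "t \<in> {0..1}"
    obtain u where u: "\<gamma> t = to_torus u" by (rule to_torus_cases)
    have "\<exists>z :: int. u $ i - Im (l i t) / (2 * pi) = of_int z" for i
    proof -
      have "exp (2 * pi * \<i> * complex_of_real (u $ i)) = exp (l i t)"
        using l(2)[OF t, of i]
        by (simp add: u torus_char_to_torus int_vec_def inner_vec_def axis_def if_distrib
            if_distribR cong: if_cong)
      then obtain z :: int where
        "2 * pi * \<i> * complex_of_real (u $ i) = l i t + complex_of_real (2 * of_int z * pi) * \<i>"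
        unfolding exp_eq by auto
      then have "2 * pi * u $ i = Im (l i t) + 2 * of_int z * pi"
        by (simp add: complex_eq_iff)
      then show ?thesis by (intro exI[of _ z]) (simp add: field_simps)
    qed
    then obtain z :: "'d \<Rightarrow> int" where "\<And>i. u $ i - Im (l i t) / (2 * pi) = of_int (z i)"
      by metis
    then have "u - (\<chi> i. Im (l i t) / (2 * pi)) = int_vec (\<chi> i. z i)"
      by (simp add: int_vec_def vec_eq_iff)
    then show "\<gamma> t = to_torus (\<chi> i. Im (l i t) / (2 * pi))"
      by (auto simp: u to_torus_eq_iff)
  qed
qed

text \<open>Discreteness of the integer lattice, used to show that two lifts differ by a locally
  constant vector.\<close>

lemma int_vec_eq_0: "norm (int_vec z) < 1 \<Longrightarrow> int_vec z = 0"
proof -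
  assume "norm (int_vec z) < 1"
  then have "\<bar>int_vec z $ i\<bar> < 1" for i
    using component_le_norm_cart[of "int_vec z" i] by linarith
  then have "z $ i = 0" for i
    by (simp add: int_vec_def flip: of_int_abs)
  then show "int_vec z = 0"
    by (simp add: int_vec_def vec_eq_iff)
qed

text \<open>The lift witnessing \<open>has_velocity\<close> may vary with \<open>t\<close> and need
  not be continuous elsewhere. Its difference to \<open>g\<close> is integer-valued and continuous
  at \<open>t\<close>, hence constant near \<open>t\<close>, so one global lift has all the
  velocities as derivatives.\<close>

lemma has_vector_derivative_lift:
  fixes \<gamma> :: "real \<Rightarrow> ('d::finite) torus"
  assumes g: "continuous_on {0..1} g" "\<And>s. s \<in> {0..1} \<Longrightarrow> \<gamma> s = to_torus (g s)"
    and t: "t \<in> {0..1}" and v: "has_velocity \<gamma> v t"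
  shows "(g has_vector_derivative v) (at t within {0..1})"
proof -
  obtain h where h: "\<And>s. s \<in> {0..1} \<Longrightarrow> \<gamma> s = to_torus (h s)"
    "(h has_vector_derivative v) (at t within {0..1})"
    using v by (auto simp: has_velocity_def)
  have "continuous (at t within {0..1}) (\<lambda>s. h s - g s)"
    using g(1) t h(2)
    by (intro continuous_diff) (auto simp: continuous_on_eq_continuous_within has_vector_derivative_continuous)
  then obtain r where r: "r > 0"
    "\<And>s. s \<in> {0..1} \<Longrightarrow> dist s t < r \<Longrightarrow> norm ((h s - g s) - (h t - g t)) < 1"
    unfolding continuous_within_eps_delta dist_norm by (metis zero_less_one)
  have "h s - (h t - g t) = g s" if s: "s \<in> {0..1}" "dist s t < r" for s
  proof -
    obtain a b where "h s - g s = int_vec a" "h t - g t = int_vec b"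
      using g(2)[OF s(1)] h(1)[OF s(1)] g(2)[OF t] h(1)[OF t] by (metis to_torus_eq_iff)
    then have "(h s - g s) - (h t - g t) = int_vec (a - b)" by (simp add: int_vec_diff)
    then have "(h s - g s) - (h t - g t) = 0" using r(2)[OF s] int_vec_eq_0 by metis
    then show ?thesis by (simp add: algebra_simps)
  qed
  moreover have "((\<lambda>s. h s - (h t - g t)) has_vector_derivative v) (at t within {0..1})"
    using has_vector_derivative_diff[OF h(2) has_vector_derivative_const] by simp
  ultimately show ?thesis
    using r(1) t by (metis (no_types, lifting) has_vector_derivative_transform_within)
qed

text \<open>Every candidate velocity is the derivative of the same lift \<open>g\<close>, which
  gives the uniqueness that the definite description in \<open>velocity\<close> requires. Interior
  parameters allow the two-sided derivative.\<close>

lemma velocity_lift: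
  fixes \<gamma> :: "real \<Rightarrow> ('d::finite) torus"
  assumes g: "continuous_on {0..1} g" "\<And>s. s \<in> {0..1} \<Longrightarrow> \<gamma> s = to_torus (g s)"
    and t: "t \<in> {0<..<1}" and v: "has_velocity \<gamma> v t"
  shows "(g has_vector_derivative velocity \<gamma> t) (at t)"
proof -
  have within: "(g has_vector_derivative u) (at t)" if "has_velocity \<gamma> u t" for u
  proof -
    have "(g has_vector_derivative u) (at t within {0..1})"
      using g that t by (intro has_vector_derivative_lift) auto
    moreover have "at t within {0..1} = at t"
      using t by (intro at_within_interior) auto
    ultimately show ?thesis by simp
  qed
  have "velocity \<gamma> t = v"
    unfolding velocity_def
    using within v vector_derivative_unique_at by (intro the_equality) blast+
  then show ?thesis using within[OF v] by simp
qed

text \<open>The displacement is the integral of the velocity, and continuity of the lift lets the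
  fundamental theorem tolerate finitely many exceptional parameters. In the Henstock-Kurzweil sense
  this integral exists by itself; only the speed needs an integrability assumption.\<close>

lemma norm_lift_diff_le:
  fixes \<gamma> :: "real \<Rightarrow> ('d::finite) torus"
  assumes g: "continuous_on {0..1} g" "\<And>s. s \<in> {0..1} \<Longrightarrow> \<gamma> s = to_torus (g s)"
    and S: "finite S" "\<And>t. t \<in> {0..1} - S \<Longrightarrow> \<exists>v. has_velocity \<gamma> v t"
    and int: "(\<lambda>t. norm (velocity \<gamma> t)) integrable_on {0..1}"
    and st: "0 \<le> s" "s \<le> t" "t \<le> 1"
  shows "norm (g t - g s) \<le> integral {s..t} (\<lambda>u. norm (velocity \<gamma> u))"
proof -
  have "(velocity \<gamma> has_integral (g t - g s)) {s..t}"
  proof (rule fundamental_theorem_of_calculus_interior_strong[OF S(1) st(2)])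
    show "(g has_vector_derivative velocity \<gamma> u) (at u)" if "u \<in> {s<..<t} - S" for u
    proof -
      obtain v where "has_velocity \<gamma> v u" using S(2)[of u] \<open>u \<in> {s<..<t} - S\<close> st by auto
      then show ?thesis using that st by (intro velocity_lift[OF g]) auto
    qed
    show "continuous_on {s..t} g" using st by (intro continuous_on_subset[OF g(1)]) auto
  qed
  moreover have "(\<lambda>u. norm (velocity \<gamma> u)) integrable_on {s..t}"
    using int by (rule integrable_on_subinterval) (use st in auto)
  ultimately show ?thesis
    by (metis integral_norm_bound_integral has_integral_integrable integral_unique order_refl)
qed

section \<open>Nets of parameters and the covering radius\<close>

text \<open>Group the parameters by the floor of \<open>K * L t\<close> and pick one from each
  occurring level. There are at most \<open>\<lfloor>K * l\<rfloor> + 1\<close> levels, and within a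
  level \<open>L\<close> varies by at most \<open>1 / K\<close>. With \<open>L\<close> the arc
  length, this cuts the curve into short pieces.\<close>

lemma level_net:
  fixes L :: "'a \<Rightarrow> real"
  assumes L: "\<And>t. t \<in> S \<Longrightarrow> 0 \<le> L t \<and> L t \<le> l" and "K > 0" "0 \<le> l"
  obtains C where "finite C" "C \<subseteq> S" "real (card C) \<le> K * l + 1"
    "\<And>t. t \<in> S \<Longrightarrow> \<exists>s\<in>C. \<bar>L t - L s\<bar> \<le> 1 / K"
proof
  define h where "h t = \<lfloor>K * L t\<rfloor>" for t
  have h: "h ` S \<subseteq> {0..\<lfloor>K * l\<rfloor>}"
    using L \<open>K > 0\<close> by (auto simp: h_def intro!: floor_mono mult_left_mono)
  then have fin: "finite (h ` S)" by (rule finite_subset) simp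
  let ?C = "inv_into S h ` h ` S"
  show "finite ?C" using fin by simp
  show "?C \<subseteq> S" by (auto intro: inv_into_into)
  have "card ?C \<le> card (h ` S)" using fin by (rule card_image_le)
  also have "\<dots> \<le> card {0..\<lfloor>K * l\<rfloor>}" using h by (intro card_mono) auto
  finally have "card ?C \<le> nat (\<lfloor>K * l\<rfloor> + 1)" by simp
  moreover have "0 \<le> \<lfloor>K * l\<rfloor>" using assms by simp
  ultimately have "int (card ?C) \<le> \<lfloor>K * l\<rfloor> + 1" by linarith
  then show "real (card ?C) \<le> K * l + 1" by linarith
  show "\<exists>s\<in>?C. \<bar>L t - L s\<bar> \<le> 1 / K" if t: "t \<in> S" for t
  proof
    let ?s = "inv_into S h (h t)"
    have "h ?s = h t" using t by (simp add: f_inv_into_f)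
    then have "\<bar>K * L t - K * L ?s\<bar> \<le> 1" unfolding h_def by linarith
    then have "K * \<bar>L t - L ?s\<bar> \<le> 1"
      using \<open>K > 0\<close> by (simp add: abs_mult flip: right_diff_distrib)
    then show "\<bar>L t - L ?s\<bar> \<le> 1 / K" using \<open>K > 0\<close> by (simp add: field_simps)
  qed (use t in auto)
qed

text \<open>No integer is closer than 1/2 to 1/2, so already one arbitrary coordinate gives the
  bound for every lattice shift.\<close>

lemma dist_torus_half: "1 / 2 \<le> dist (to_torus x) (to_torus (x + (\<chi> i. 1 / 2)))"
  unfolding dist_to_torus
proof (rule cINF_greatest)
  fix z :: "int ^ 'a"
  obtain i :: 'a where True by simp
  have "z $ i \<le> 0 \<or> 1 \<le> z $ i" by linarith
  then have "real_of_int (z $ i) \<le> 0 \<or> 1 \<le> real_of_int (z $ i)" by simp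
  then have "1 / 2 \<le> \<bar>- (1 / 2) + real_of_int (z $ i)\<bar>" by linarith
  also have "\<dots> = \<bar>(x - (x + (\<chi> i. 1 / 2)) + int_vec z) $ i\<bar>" by (simp add: int_vec_def)
  also have "\<dots> \<le> infnorm (x - (x + (\<chi> i. 1 / 2)) + int_vec z)" by (rule component_le_infnorm_cart)
  finally show "1 / 2 \<le> infnorm (x - (x + (\<chi> i. 1 / 2)) + int_vec z)" .
qed simp

text \<open>The infimum over \<open>Y\<close> need not be attained, hence the strict bound. The
  boundedness checks are what makes the real-valued infimum and supremum meaningful.\<close>

lemma covering_radius_less:
  assumes "covering_radius Y < r" and "Y \<noteq> {}"
  obtains y where "y \<in> Y" "dist y x < r"
proof -
  obtain y0 where y0: "y0 \<in> Y" using assms(2) by auto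
  have below: "bdd_below ((\<lambda>y. dist y x) ` Y)" for x
    by (auto intro!: bdd_belowI2[where m = 0])
  have "(INF y\<in>Y. dist y x) \<le> real CARD('a)" for x
    using cINF_lower2[OF below y0 dist_torus_bounded] .
  then have "bdd_above (range (\<lambda>x. INF y\<in>Y. dist y x))"
    by (auto intro!: bdd_aboveI2)
  then have "(INF y\<in>Y. dist y x) \<le> covering_radius Y"
    unfolding covering_radius_def by (intro cSUP_upper) auto
  then have "(INF y\<in>Y. dist y x) < r" using assms(1) by simp
  then obtain y where "y \<in> Y" "dist y x < r"
    using assms(2) below by (auto simp: cINF_less_iff)
  then show thesis by (rule that)
qed

text \<open>The lift is 1-Lipschitz in the arc length measured from parameter 0, whatever the order
  of the two parameters.\<close>

lemma norm_lift_diff_le_abs: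
  fixes \<gamma> :: "real \<Rightarrow> ('d::finite) torus"
  assumes g: "continuous_on {0..1} g" "\<And>s. s \<in> {0..1} \<Longrightarrow> \<gamma> s = to_torus (g s)"
    and S: "finite S" "\<And>t. t \<in> {0..1} - S \<Longrightarrow> \<exists>v. has_velocity \<gamma> v t"
    and int: "(\<lambda>t. norm (velocity \<gamma> t)) integrable_on {0..1}"
    and st: "s \<in> {0..1}" "t \<in> {0..1}"
  shows "norm (g t - g s) \<le>
    \<bar>integral {0..t} (\<lambda>u. norm (velocity \<gamma> u)) - integral {0..s} (\<lambda>u. norm (velocity \<gamma> u))\<bar>"
  using st
proof (induction s t rule: linorder_wlog)
  case (le s t)
  then have "integral {0..s} (\<lambda>u. norm (velocity \<gamma> u)) + integral {s..t} (\<lambda>u. norm (velocity \<gamma> u)) =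
      integral {0..t} (\<lambda>u. norm (velocity \<gamma> u))"
    by (intro Henstock_Kurzweil_Integration.integral_combine integrable_on_subinterval[OF int]) auto
  then show ?case using norm_lift_diff_le[OF g S int, of s t] le by auto
next
  case (sym s t)
  then show ?case by (simp add: norm_minus_commute abs_minus_commute)
qed

section \<open>The quadrature identity and the length bound\<close>

text \<open>A nonzero value \<open>c\<close> itself forces integrability and
  \<open>l \<noteq> 0\<close>: a non-integrable function has Bochner integral 0, and
  \<open>1 / 0\<close> is 0, so either failure would make the left side vanish.\<close>

lemma quadrature_real:
  fixes F w :: "('d::finite) torus \<Rightarrow> real"
  assumes "1 / complex_of_real l *
      curve_integral \<gamma> (\<lambda>x. complex_of_real (F x) * complex_of_real (w x)) = complex_of_real c"
    and "c \<noteq> 0"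
  shows "integrable (lebesgue_on {0..1}) (\<lambda>t. F (\<gamma> t) * (norm (velocity \<gamma> t) * w (\<gamma> t)))"
    and "(LINT t|lebesgue_on {0..1}. F (\<gamma> t) * (norm (velocity \<gamma> t) * w (\<gamma> t))) = l * c"
    and "l \<noteq> 0"
proof -
  let ?J = "LINT t|lebesgue_on {0..1}. F (\<gamma> t) * (norm (velocity \<gamma> t) * w (\<gamma> t))"
  have "curve_integral \<gamma> (\<lambda>x. complex_of_real (F x) * complex_of_real (w x)) =
      (LINT t|lebesgue_on {0..1}. complex_of_real (F (\<gamma> t) * (norm (velocity \<gamma> t) * w (\<gamma> t))))"
    unfolding curve_integral_def
    by (intro Bochner_Integration.integral_cong refl) (simp add: scaleR_conv_of_real mult_ac)
  also have "\<dots> = complex_of_real ?J" by (rule integral_complex_of_real)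
  finally have "complex_of_real (?J / l) = complex_of_real c" using assms(1) by simp
  then have J: "?J / l = c" by (simp only: of_real_eq_iff)
  with \<open>c \<noteq> 0\<close> show "l \<noteq> 0" by auto
  with J show "?J = l * c" by (simp add: field_simps)
  then show "integrable (lebesgue_on {0..1}) (\<lambda>t. F (\<gamma> t) * (norm (velocity \<gamma> t) * w (\<gamma> t)))"
    using \<open>c \<noteq> 0\<close> \<open>l \<noteq> 0\<close> not_integrable_integral_eq by fastforce
qed

lemma constant_in_trig_poly: "(\<lambda>_. 1) \<in> trig_poly N"
  using torus_char_in_trig_poly[of 0 N] by (simp add: torus_char_0[abs_def] trig_freqs_def)

text \<open>The left side is at most 16 (d + 1), hence at most \<open>2 ^ (d + 4)\<close>, and d + 4
  is at most d (d + 1) once d is at least 2. For d = 1 the inequality fails, 16 against 4.\<close>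

lemma power_dimension_bound:
  assumes "d \<ge> 2"
  shows "4 * (3 * real d + 1) \<le> 2 ^ (d * (d + 1))"
proof -
  have "d + 1 \<le> 2 ^ d" using less_exp[of d] by linarith
  then have "real (d + 1) \<le> real (2 ^ d)" by (simp only: of_nat_le_iff)
  then have "4 * (3 * real d + 1) \<le> 2 ^ (d + 4)" by (simp add: power_add)
  also have "2 * 2 \<le> d * d" using assms by (intro mult_le_mono)
  then have "(2 :: real) ^ (d + 4) \<le> 2 ^ (d * (d + 1))"
    by (intro power_increasing) (auto simp: algebra_simps)
  finally show ?thesis .
qed

theorem corollary3p9:
  fixes \<gamma> :: "real \<Rightarrow> ('d::finite) torus"
    and w :: "'d torus \<Rightarrow> real"
    and n :: nat
  assumes "n \<ge> 1"
    and "piecewise_differentiable_curve \<gamma>"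
    and "\<gamma> 0 = \<gamma> 1"
    and "finite (self_intersections \<gamma>)"
    and "covering_radius (\<gamma> ` {0..1}) \<le> 1 / 8"
    and "\<And>x. x \<in> \<gamma> ` {0..1} \<Longrightarrow> 0 \<le> w x"
    and "(\<lambda>t. norm (velocity \<gamma> t) * w (\<gamma> t)) \<in> borel_measurable (lebesgue_on {0..1})"
    and "\<And>f. f \<in> trig_poly (2 * n) \<Longrightarrow>
      1 / complex_of_real (curve_length \<gamma>) * curve_integral \<gamma> (\<lambda>x. f x * complex_of_real (w x)) =
      (LINT x|torus_measure. f x)"
  shows "curve_length \<gamma> \<ge> 1 / 2 ^ (CARD('d) * (CARD('d) + 1)) * real (2 * n + 1) ^ (CARD('d) - 1)"
proof -
  define l where "l = curve_length \<gamma>"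
  define d where "d = CARD('d)"
  define N where "N = real (2 * n + 1)"
  define L where "L t = integral {0..t} (\<lambda>u. norm (velocity \<gamma> u))" for t
  define W where "W t = norm (velocity \<gamma> t) * w (\<gamma> t)" for t
  have d: "d > 0" by (simp add: d_def)
  have N: "N \<ge> 3" using assms(1) by (simp add: N_def)
  have W: "W t \<ge> 0" if "t \<in> {0..1}" for t
    using assms(6) that by (simp add: W_def)

  \<comment> \<open>Testing with the constant 1 shows that the weighted mass of the curve equals its
    length, and that the length is not 0.\<close>
  have one: "1 / complex_of_real l * curve_integral \<gamma> (\<lambda>x. complex_of_real 1 * complex_of_real (w x)) =
      complex_of_real 1"
    using assms(8)[OF constant_in_trig_poly] integral_torus_char[where k = "0 :: int ^ 'd"]
    by (simp add: l_def torus_char_0)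
  have intW: "integrable (lebesgue_on {0..1}) W" "integral\<^sup>L (lebesgue_on {0..1}) W = l"
    and "l \<noteq> 0"
    using quadrature_real[OF one] by (simp_all add: W_def[abs_def])
  have l_eq: "l = (LINT t|lebesgue_on {0..1}. norm (velocity \<gamma> t))"
    by (simp add: l_def curve_length_def curve_integral_def)
  \<comment> \<open>A curve with non-integrable speed would have \<open>curve_length\<close> 0 by
    default, so finite length follows here.\<close>
  with \<open>l \<noteq> 0\<close> have "integrable (lebesgue_on {0..1}) (\<lambda>t. norm (velocity \<gamma> t))"
    using not_integrable_integral_eq by fastforce
  then have speed: "(\<lambda>t. norm (velocity \<gamma> t)) integrable_on {0..1}" and L1: "L 1 = l"
    by (simp_all add: integrable_on_lebesgue_on lebesgue_integral_eq_integral L_def l_eq)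
  have L0: "L 0 = 0" by (simp add: L_def)
  have L: "0 \<le> L t \<and> L t \<le> l" if "t \<in> {0..1}" for t
  proof
    have "(\<lambda>u. norm (velocity \<gamma> u)) integrable_on {0..t}"
      using that by (intro integrable_on_subinterval[OF speed]) auto
    then show "0 \<le> L t" unfolding L_def by (rule integral_nonneg) simp
    show "L t \<le> l" unfolding L1[symmetric] L_def
      using that by (intro integral_subset_le integrable_on_subinterval[OF speed]) auto
  qed
  then have l: "l > 0" using \<open>l \<noteq> 0\<close> L[of 1] L1 by simp

  obtain g where g: "continuous_on {0..1} g" "\<And>t. t \<in> {0..1} \<Longrightarrow> \<gamma> t = to_torus (g t)"
    using assms(2) torus_continuous_lift unfolding piecewise_differentiable_curve_def by blast
  obtain S where S: "finite S" "\<And>t. t \<in> {0..1} - S \<Longrightarrow> \<exists>v. has_velocity \<gamma> v t"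
    using assms(2) unfolding piecewise_differentiable_curve_def by blast
  have gL: "norm (g t - g s) \<le> \<bar>L t - L s\<bar>" if "s \<in> {0..1}" "t \<in> {0..1}" for s t
    unfolding L_def by (rule norm_lift_diff_le_abs[OF g S speed that])

  \<comment> \<open>The curve starts at distance at least \<open>1/2\<close> from \<open>x\<close> and must come within \<open>1/6 > 1/8\<close> of it.\<close>
  have l3: "1 / 3 \<le> l"
  proof -
    define x where "x = to_torus (g 0 + (\<chi> i. 1 / 2))"
    have "covering_radius (\<gamma> ` {0..1}) < 1 / 6" using assms(5) by simp
    then obtain t where t: "t \<in> {0..1}" "dist (\<gamma> t) x < 1 / 6"
      by (rule covering_radius_less[of _ _ x]) auto
    have "dist (\<gamma> t) (to_torus (g 0)) \<le> \<bar>L t - L 0\<bar>"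
      using dist_to_torus_le[of "g t" "g 0"] gL[of 0 t] t(1) g(2)[OF t(1)] by simp
    also have "\<dots> \<le> l" using L[OF t(1)] L0 by simp
    finally have "dist (\<gamma> t) (to_torus (g 0)) \<le> l" .
    moreover have "1 / 2 \<le> dist (to_torus (g 0)) x"
      unfolding x_def by (rule dist_torus_half)
    moreover have "dist (to_torus (g 0)) x \<le> dist (\<gamma> t) (to_torus (g 0)) + dist (\<gamma> t) x"
      by (metis dist_commute dist_triangle)
    ultimately show ?thesis using t(2) by linarith
  qed

  \<comment> \<open>The reciprocal of \<open>K\<close> is the radius within which a concentrated
    kernel is known to be large.\<close>
  define K where "K = 3 * N * real d"
  have K: "K > 0" using N d by (simp add: K_def)
  obtain C where C: "finite C" "C \<subseteq> {0..1}" "real (card C) \<le> K * l + 1"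
    "\<And>t. t \<in> {0..1} \<Longrightarrow> \<exists>s\<in>C. \<bar>L t - L s\<bar> \<le> 1 / K"
    using level_net[of "{0..1}" L l K] L K l by (metis less_imp_le)
  have "\<exists>F. (\<lambda>x. complex_of_real (F x)) \<in> trig_poly (2 * n) \<and>
      (LINT x|torus_measure. complex_of_real (F x)) = complex_of_real (N ^ d) \<and> (\<forall>x. 0 \<le> F x) \<and>
      (\<forall>y. norm (y - g s) \<le> 1 / K \<longrightarrow> (N ^ d / 2)\<^sup>2 \<le> F (to_torus y))" for s
    by (rule concentrated_trig_poly[of n "g s"]) (auto simp: N_def d_def K_def intro!: exI)
  then obtain F where F: "\<And>s. (\<lambda>x. complex_of_real (F s x)) \<in> trig_poly (2 * n)"
    "\<And>s. (LINT x|torus_measure. complex_of_real (F s x)) = complex_of_real (N ^ d)"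
    "\<And>s x. 0 \<le> F s x"
    "\<And>s y. norm (y - g s) \<le> 1 / K \<Longrightarrow> (N ^ d / 2)\<^sup>2 \<le> F s (to_torus y)"
    by metis
  have FW: "integrable (lebesgue_on {0..1}) (\<lambda>t. F s (\<gamma> t) * W t)"
    "(LINT t|lebesgue_on {0..1}. F s (\<gamma> t) * W t) = l * N ^ d" for s
    using quadrature_real[of l \<gamma> "F s" w "N ^ d"] assms(8)[OF F(1)[of s]] F(2)[of s] N
    by (simp_all add: W_def l_def)

  \<comment> \<open>Every point of the curve lies near some centre, so the sum of the kernels over
    \<open>C\<close> is at least \<open>(N ^ d / 2)\<^sup>2\<close> along the whole curve.
    Integrating against \<open>W\<close> compares this with the exact mass \<open>l * N ^ d\<close>
    of each kernel.\<close>
  have "(N ^ d / 2)\<^sup>2 * l = (LINT t|lebesgue_on {0..1}. (N ^ d / 2)\<^sup>2 * W t)"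
    by (simp add: intW)
  also have "\<dots> \<le> (LINT t|lebesgue_on {0..1}. (\<Sum>s\<in>C. F s (\<gamma> t) * W t))"
  proof (rule integral_mono)
    fix t :: real assume "t \<in> space (lebesgue_on {0..1})"
    then have t: "t \<in> {0..1}" by simp
    obtain s where s: "s \<in> C" "\<bar>L t - L s\<bar> \<le> 1 / K" using C(4)[OF t] by blast
    then have "(N ^ d / 2)\<^sup>2 \<le> F s (\<gamma> t)"
      using gL[of s t] t C(2) by (auto simp: g(2) intro!: F(4))
    also have "\<dots> \<le> (\<Sum>s\<in>C. F s (\<gamma> t))"
      using s(1) C(1) F(3) by (intro member_le_sum) auto
    finally show "(N ^ d / 2)\<^sup>2 * W t \<le> (\<Sum>s\<in>C. F s (\<gamma> t) * W t)"
      unfolding sum_distrib_right[symmetric] using W[OF t] by (rule mult_right_mono)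
  qed (use intW FW in auto)
  also have "\<dots> = real (card C) * (l * N ^ d)"
    by (simp add: FW)
  finally have "N ^ d * (l * N ^ d) \<le> (4 * real (card C)) * (l * N ^ d)"
    by (simp add: power2_eq_square field_simps)
  then have "N ^ d \<le> 4 * real (card C)"
    using l N by (simp add: mult_le_cancel_right)
  \<comment> \<open>The additive 1 in the size of the net is absorbed by
    \<open>N * l \<ge> 1\<close>, making the bound linear in \<open>l\<close> so that one factor
    \<open>N\<close> cancels.\<close>
  also have "\<dots> \<le> 4 * (K * l + N * l)"
  proof -
    have "3 * (1 / 3) \<le> N * l" using N l3 by (intro mult_mono) auto
    then show ?thesis using C(3) by simp
  qed
  also have "\<dots> = N * (4 * (3 * real d + 1) * l)" by (simp add: K_def algebra_simps)
  finally have "N * N ^ (d - 1) \<le> N * (4 * (3 * real d + 1) * l)"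
    using d by (simp flip: power_Suc)
  then have main: "N ^ (d - 1) \<le> 4 * (3 * real d + 1) * l" using N by simp
  have "N ^ (d - 1) \<le> 2 ^ (d * (d + 1)) * l"
  proof (cases "d \<ge> 2")
    case True
    then show ?thesis
      using main mult_right_mono[OF power_dimension_bound[OF True], of l] l by linarith
  next
    case False
    \<comment> \<open>In dimension one the claim reads \<open>1 \<le> 4 * l\<close>, so the bound
      from the covering radius is enough.\<close>
    then have "d = 1" using d by simp
    then show ?thesis using l3 by simp
  qed
  then show ?thesis unfolding l_def[symmetric] N_def[symmetric] d_def[symmetric]
    by (simp add: field_simps)
qed

end
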